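(* Let $X$ and $Y$ be L-algebras such that $Y$ operates on $X$ via $\rho$, and let $K\subseteq X\rtimes_\rho Y$, with $K_X=\{x\in X\mid (x,1)\in K\}$ and $K_Y=\{y\in Y\mid (1,y)\in K\}$. Then $K$ is an ideal of $X\rtimes_\rho Y$ if and only if $\rho$ induces an operation $$\tilde\rho: Y/K_Y\longrightarrow \mathrm{End}(X/K_X)$$ such that $$(X\rtimes_\rho Y)\big/(K_X\rtimes_{\rho|_{K_Y}}K_Y)\;\cong\; X/K_X\rtimes_{\tilde\rho}Y/K_Y .$$
   Context: An L-algebra is a set $X$ with a binary operation $\cdot$ and a distinguished element $1$ such that for all $x,y,z\in X$: $1\cdot x=x$ and $x\cdot 1=x\cdot x=1$; $(x\cdot y)\cdot(x\cdot z)=(y\cdot x)\cdot(y\cdot z)$; and $x\cdot y=y\cdot x=1$ implies $x=y$. $\mathrm{End}(X)$ is the set of maps $f:X\to X$ with $f(x\cdot y)=f(x)\cdot f(y)$, and $\cong$ denotes isomorphism of L-algebras. An ideal of $X$ is a nonempty subset $I\subseteq X$ such that for all $x\in I$, $y\in X$: (I1) $x\cdot y\in I$ implies $y\in I$; (I2) $y\cdot x\in I$; (I3) $(x\cdot y)\cdot y\in I$; (I4) $y\cdot(x\cdot y)\in I$. For an ideal $I$, the relation $x\equiv y\iff x\cdot y\in I$ and $y\cdot x\in I$ is a congruence, and $X/I$ denotes the quotient L-algebra, with classes $[x]$. Writing a quotient presupposes that the subset divided out is an ideal. An L-algebra $Y$ operates on an L-algebra $X$ via $\rho:Y\to\mathrm{End}(X)$,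 $u\mapsto\rho_u$, if $\rho_1=\mathrm{id}$ and $\rho_{u\cdot v}\circ\rho_u=\rho_{v\cdot u}\circ\rho_v$ for all $u,v\in Y$; such a $\rho$ is called an operation. The semidirect product $X\rtimes_\rho Y$ is the L-algebra on $X\times Y$ with operation $(x,u)\cdot(y,v)=(\rho_{u\cdot v}(x)\cdot\rho_{v\cdot u}(y),\,u\cdot v)$. That $\rho$ induces $\tilde\rho$ means that $\tilde\rho_{[v]}([x])=[\rho_v(x)]$ is well defined for $v\in Y$, $x\in X$. $K_X\rtimes_{\rho|_{K_Y}}K_Y$ is the semidirect product of $K_X$ and $K_Y$ with respect to the restriction of $\rho$, with underlying set $K_X\times K_Y\subseteq X\rtimes_\rho Y$.
   Formalization: The right-hand side also requires that K equal the underlying set K_X × K_Y of the semidirect product of K_X and K_Y; for an arbitrary subset K the "if" direction is false without this, and every ideal K satisfies it. *)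

theory Defs
  imports "HOL-Algebra.Group"
begin

text \<open>
  The record \<^type>\<open>monoid_scheme\<close> serves purely as a signature (a carrier, a binary operation, a
  constant): \<open>x \<otimes> y\<close> is the operation of an L-algebra, which need not be associative, and \<open>\<one>\<close> its
  distinguished element. The library's \<^const>\<open>hom\<close> and \<open>\<cong>\<close> refer only to the carrier and the
  operation. A homomorphism of L-algebras preserves \<open>\<one>\<close> automatically, as \<open>\<one> = x \<otimes> x\<close>.
\<close>

locale l_algebra =
  fixes X (structure)
  assumes one_closed: "\<one> \<in> carrier X"
    and op_closed: "\<lbrakk>x \<in> carrier X; y \<in> carrier X\<rbrakk> \<Longrightarrow> x \<otimes> y \<in> carrier X"
    and one_op: "x \<in> carrier X \<Longrightarrow> \<one> \<otimes> x = x"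
    and op_one: "x \<in> carrier X \<Longrightarrow> x \<otimes> \<one> = \<one>"
    and op_self: "x \<in> carrier X \<Longrightarrow> x \<otimes> x = \<one>"
    and cycloid: "\<lbrakk>x \<in> carrier X; y \<in> carrier X; z \<in> carrier X\<rbrakk>
      \<Longrightarrow> (x \<otimes> y) \<otimes> (x \<otimes> z) = (y \<otimes> x) \<otimes> (y \<otimes> z)"
    and antisym: "\<lbrakk>x \<in> carrier X; y \<in> carrier X; x \<otimes> y = \<one>; y \<otimes> x = \<one>\<rbrakk> \<Longrightarrow> x = y"

definition l_ideal :: "('a, 'm) monoid_scheme \<Rightarrow> 'a set \<Rightarrow> bool" where
  "l_ideal X I \<longleftrightarrow> I \<noteq> {} \<and> I \<subseteq> carrier X \<and>
    (\<forall>x\<in>I. \<forall>y\<in>carrier X.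
      (x \<otimes>\<^bsub>X\<^esub> y \<in> I \<longrightarrow> y \<in> I) \<and>
      y \<otimes>\<^bsub>X\<^esub> x \<in> I \<and>
      (x \<otimes>\<^bsub>X\<^esub> y) \<otimes>\<^bsub>X\<^esub> y \<in> I \<and>
      y \<otimes>\<^bsub>X\<^esub> (x \<otimes>\<^bsub>X\<^esub> y) \<in> I)"

definition l_cong :: "('a, 'm) monoid_scheme \<Rightarrow> 'a set \<Rightarrow> ('a \<times> 'a) set" where
  "l_cong X I = {(x, y). x \<in> carrier X \<and> y \<in> carrier X \<and> x \<otimes>\<^bsub>X\<^esub> y \<in> I \<and> y \<otimes>\<^bsub>X\<^esub> x \<in> I}"

definition l_class :: "('a, 'm) monoid_scheme \<Rightarrow> 'a set \<Rightarrow> 'a \<Rightarrow> 'a set" where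
  "l_class X I x = l_cong X I `` {x}"

text \<open>
  When \<open>I\<close> is an ideal, \<^const>\<open>l_cong\<close> is a congruence, so the union below is taken over copies of
  one and the same class and \<open>[a] \<otimes> [b] = [a \<otimes> b]\<close>. For other sets \<open>I\<close> the term has no meaning.
\<close>

definition l_quot :: "('a, 'm) monoid_scheme \<Rightarrow> 'a set \<Rightarrow> 'a set monoid" where
  "l_quot X I =
    \<lparr>carrier = carrier X // l_cong X I,
     mult = (\<lambda>A B. \<Union>a\<in>A. \<Union>b\<in>B. l_class X I (a \<otimes>\<^bsub>X\<^esub> b)),
     one = l_class X I \<one>\<^bsub>X\<^esub>\<rparr>"

definition operates ::
  "('b, 'n) monoid_scheme \<Rightarrow> ('a, 'm) monoid_scheme \<Rightarrow> ('b \<Rightarrow> 'a \<Rightarrow> 'a) \<Rightarrow> bool" where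
  "operates Y X \<rho> \<longleftrightarrow>
    (\<forall>u\<in>carrier Y. \<rho> u \<in> hom X X) \<and>
    (\<forall>x\<in>carrier X. \<rho> \<one>\<^bsub>Y\<^esub> x = x) \<and>
    (\<forall>u\<in>carrier Y. \<forall>v\<in>carrier Y. \<forall>x\<in>carrier X.
      \<rho> (u \<otimes>\<^bsub>Y\<^esub> v) (\<rho> u x) = \<rho> (v \<otimes>\<^bsub>Y\<^esub> u) (\<rho> v x))"

definition semidirect ::
  "('a, 'm) monoid_scheme \<Rightarrow> ('b \<Rightarrow> 'a \<Rightarrow> 'a) \<Rightarrow> ('b, 'n) monoid_scheme \<Rightarrow> ('a \<times> 'b) monoid" where
  "semidirect X \<rho> Y =
    \<lparr>carrier = carrier X \<times> carrier Y,
     mult = (\<lambda>(x, u) (y, v). (\<rho> (u \<otimes>\<^bsub>Y\<^esub> v) x \<otimes>\<^bsub>X\<^esub> \<rho> (v \<otimes>\<^bsub>Y\<^esub> u) y, u \<otimes>\<^bsub>Y\<^esub> v)),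
     one = (\<one>\<^bsub>X\<^esub>, \<one>\<^bsub>Y\<^esub>)\<rparr>"

text \<open>
  A map \<open>\<rho>'\<close> on classes with the following property exists iff \<open>[x], [v] \<mapsto> [\<rho> v x]\<close> is well defined,
  and it is then unique on the classes of elements.
\<close>

definition induces ::
  "('a, 'm) monoid_scheme \<Rightarrow> 'a set \<Rightarrow> ('b, 'n) monoid_scheme \<Rightarrow> 'b set \<Rightarrow>
    ('b \<Rightarrow> 'a \<Rightarrow> 'a) \<Rightarrow> ('b set \<Rightarrow> 'a set \<Rightarrow> 'a set) \<Rightarrow> bool" where
  "induces X I Y J \<rho> \<rho>' \<longleftrightarrow>
    (\<forall>v\<in>carrier Y. \<forall>x\<in>carrier X. \<rho>' (l_class Y J v) (l_class X I x) = l_class X I (\<rho> v x))"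

end

theory Submission
  imports Defs
begin

text \<open>
  Everything is governed by the map \<open>(x, u) \<mapsto> ([x], [u])\<close>. If \<open>\<rho>\<close> induces a map on classes, it is a
  homomorphism into the semidirect product of the quotients, and its kernel \<open>K_X \<times> K_Y\<close> is an ideal
  because kernels are. Conversely, let \<open>K\<close> be an ideal. From \<open>(1, u) \<cdot> (x, u) = (x, 1)\<close> one reads off
  \<open>K = K_X \<times> K_Y\<close>. From \<open>(1, w) \<cdot> (x, 1) = (\<rho>\<^sub>w x, 1)\<close> one gets that each \<open>\<rho>\<^sub>w\<close> preserves \<open>K_X\<close>, and, via
  (I3) and (I4), that \<open>\<rho>\<^sub>w x \<equiv> x\<close> for \<open>w \<in> K_Y\<close>. As \<open>\<rho>\<^bsub>v\<cdot>v'\<^esub> \<circ> \<rho>\<^sub>v = \<rho>\<^bsub>v'\<cdot>v\<^esub> \<circ> \<rho>\<^bsub>v'\<^esub>\<close>, it follows that \<open>\<rho>\<close>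
  passes to classes and that the kernel pair of the map above is the congruence of \<open>K\<close>.
\<close>

section \<open>Ideals and their congruences\<close>

lemma l_idealD:
  assumes "l_ideal X I" and "x \<in> I"
  shows l_ideal_mem_carrier: "x \<in> carrier X"
    and l_ideal_I1: "\<lbrakk>y \<in> carrier X; x \<otimes>\<^bsub>X\<^esub> y \<in> I\<rbrakk> \<Longrightarrow> y \<in> I"
    and l_ideal_I2: "y \<in> carrier X \<Longrightarrow> y \<otimes>\<^bsub>X\<^esub> x \<in> I"
    and l_ideal_I3: "y \<in> carrier X \<Longrightarrow> (x \<otimes>\<^bsub>X\<^esub> y) \<otimes>\<^bsub>X\<^esub> y \<in> I"
    and l_ideal_I4: "y \<in> carrier X \<Longrightarrow> y \<otimes>\<^bsub>X\<^esub> (x \<otimes>\<^bsub>X\<^esub> y) \<in> I"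
  using assms unfolding l_ideal_def by blast+

lemma carrier_l_quot: "carrier (l_quot X I) = l_class X I ` carrier X"
  unfolding l_quot_def quotient_def l_class_def by auto

context l_algebra
begin

lemma l_ideal_one:
  assumes "l_ideal X I"
  shows "\<one> \<in> I"
proof -
  obtain x where "x \<in> I"
    using assms unfolding l_ideal_def by blast
  then have "x \<otimes> x \<in> I"
    by (metis assms l_ideal_I2 l_ideal_mem_carrier)
  then show ?thesis
    using \<open>x \<in> I\<close> assms l_ideal_mem_carrier op_self by metis
qed

text \<open>By (I2), \<open>b \<otimes> c \<in> I\<close> puts
  \<open>(b \<otimes> a) \<otimes> (b \<otimes> c)\<close> into \<open>I\<close>. The cycloid law
  turns this into \<open>(a \<otimes> b) \<otimes> (a \<otimes> c)\<close>, and (I1) strips off the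
  factor \<open>a \<otimes> b \<in> I\<close>.\<close>

lemma l_cong_trans:
  assumes I: "l_ideal X I" and xy: "(x, y) \<in> l_cong X I" and yz: "(y, z) \<in> l_cong X I"
  shows "(x, z) \<in> l_cong X I"
proof -
  have half: "a \<otimes> c \<in> I"
    if "a \<in> carrier X" "b \<in> carrier X" "c \<in> carrier X" "a \<otimes> b \<in> I" "b \<otimes> c \<in> I" for a b c
  proof -
    have "(b \<otimes> a) \<otimes> (b \<otimes> c) \<in> I"
      using that I l_ideal_I2 op_closed by metis
    then have "(a \<otimes> b) \<otimes> (a \<otimes> c) \<in> I"
      using that cycloid by metis
    then show ?thesis
      using that I l_ideal_I1 op_closed by metis
  qed
  show ?thesis
    using xy yz half unfolding l_cong_def by blast
qed

lemma equiv_l_cong: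
  assumes "l_ideal X I"
  shows "equiv (carrier X) (l_cong X I)"
proof (rule equivI)
  show "l_cong X I \<subseteq> carrier X \<times> carrier X"
    unfolding l_cong_def by blast
  show "refl_on (carrier X) (l_cong X I)"
    unfolding refl_on_def l_cong_def by (simp add: op_self l_ideal_one[OF assms])
  show "sym (l_cong X I)"
    unfolding sym_def l_cong_def by simp
  show "trans (l_cong X I)"
    using l_cong_trans[OF assms] by (rule transI)
qed

text \<open>The two memberships are (I4) and (I3) verbatim. This is how these two conditions enter
  the congruence.\<close>

lemma l_cong_op_ideal:
  assumes "l_ideal X I" and "a \<in> I" and "x \<in> carrier X"
  shows "(x, a \<otimes> x) \<in> l_cong X I"
  using assms(3) op_closed l_ideal_mem_carrier[OF assms(1,2)]
    l_ideal_I3[OF assms] l_ideal_I4[OF assms] unfolding l_cong_def by simp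

text \<open>The middle term is \<open>(x \<otimes> y) \<otimes> (x \<otimes> z)\<close>, which the
  cycloid law equates with \<open>(y \<otimes> x) \<otimes> (y \<otimes> z)\<close>. As
  \<open>x \<otimes> y\<close> and \<open>y \<otimes> x\<close> lie in \<open>I\<close>, it is
  congruent to \<open>x \<otimes> z\<close> and to \<open>y \<otimes> z\<close>.\<close>

lemma l_cong_op_left:
  assumes I: "l_ideal X I" and xy: "(x, y) \<in> l_cong X I" and z: "z \<in> carrier X"
  shows "(x \<otimes> z, y \<otimes> z) \<in> l_cong X I"
proof -
  have x: "x \<in> carrier X" and y: "y \<in> carrier X" and xyI: "x \<otimes> y \<in> I" and yxI: "y \<otimes> x \<in> I"
    using xy unfolding l_cong_def by auto
  have "(x \<otimes> z, (x \<otimes> y) \<otimes> (x \<otimes> z)) \<in> l_cong X I"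
    by (intro l_cong_op_ideal I xyI op_closed x z)
  moreover have "(y \<otimes> z, (x \<otimes> y) \<otimes> (x \<otimes> z)) \<in> l_cong X I"
    unfolding cycloid[OF x y z] by (intro l_cong_op_ideal I yxI op_closed y z)
  then have "((x \<otimes> y) \<otimes> (x \<otimes> z), y \<otimes> z) \<in> l_cong X I"
    unfolding l_cong_def by simp
  ultimately show ?thesis
    by (rule l_cong_trans[OF I])
qed

text \<open>The cycloid law rewrites \<open>(z \<otimes> x) \<otimes> (z \<otimes> y)\<close> as
  \<open>(x \<otimes> z) \<otimes> (x \<otimes> y)\<close>, to which (I2) applies.\<close>

lemma l_cong_op_right:
  assumes I: "l_ideal X I" and xy: "(x, y) \<in> l_cong X I" and z: "z \<in> carrier X"
  shows "(z \<otimes> x, z \<otimes> y) \<in> l_cong X I"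
proof -
  have x: "x \<in> carrier X" and y: "y \<in> carrier X" and xyI: "x \<otimes> y \<in> I" and yxI: "y \<otimes> x \<in> I"
    using xy unfolding l_cong_def by auto
  have "(z \<otimes> x) \<otimes> (z \<otimes> y) \<in> I" "(z \<otimes> y) \<otimes> (z \<otimes> x) \<in> I"
    unfolding cycloid[OF z x y] cycloid[OF z y x]
    by (intro l_ideal_I2[OF I] xyI yxI op_closed x y z)+
  then show ?thesis
    using op_closed x y z unfolding l_cong_def by simp
qed

lemma l_cong_op:
  assumes I: "l_ideal X I" and "(a, a') \<in> l_cong X I" and "(b, b') \<in> l_cong X I"
  shows "(a \<otimes> b, a' \<otimes> b') \<in> l_cong X I"
proof -
  have "a' \<in> carrier X" "b \<in> carrier X"
    using assms unfolding l_cong_def by auto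
  then show ?thesis
    using l_cong_trans[OF I l_cong_op_left l_cong_op_right] assms by simp
qed

section \<open>Classes and the quotient\<close>

lemma l_class_eq_iff:
  assumes "l_ideal X I" and "x \<in> carrier X" and "y \<in> carrier X"
  shows "l_class X I x = l_class X I y \<longleftrightarrow> (x, y) \<in> l_cong X I"
  unfolding l_class_def by (rule eq_equiv_class_iff[OF equiv_l_cong[OF assms(1)] assms(2,3)])

lemma l_class_eq_one_iff:
  assumes "l_ideal X I" and "x \<in> carrier X"
  shows "l_class X I x = l_class X I \<one> \<longleftrightarrow> x \<in> I"
  using assms(2)
  by (simp add: l_class_eq_iff[OF assms(1)] l_cong_def l_ideal_one[OF assms(1)] one_op op_one
      one_closed)

lemma self_in_l_class:
  assumes "l_ideal X I" and "x \<in> carrier X"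
  shows "x \<in> l_class X I x"
  unfolding l_class_def by (rule equiv_class_self[OF equiv_l_cong[OF assms(1)] assms(2)])

lemma l_class_mult:
  assumes I: "l_ideal X I" and a: "a \<in> carrier X" and b: "b \<in> carrier X"
  shows "l_class X I a \<otimes>\<^bsub>l_quot X I\<^esub> l_class X I b = l_class X I (a \<otimes> b)"
proof -
  have eq: "l_class X I (a' \<otimes> b') = l_class X I (a \<otimes> b)"
    if "a' \<in> l_class X I a" "b' \<in> l_class X I b" for a' b'
  proof -
    have "(a \<otimes> b, a' \<otimes> b') \<in> l_cong X I"
      using that l_cong_op[OF I] unfolding l_class_def by blast
    then show ?thesis
      unfolding l_class_def by (rule equiv_class_eq[OF equiv_l_cong[OF I], symmetric])
  qed
  have "l_class X I a \<otimes>\<^bsub>l_quot X I\<^esub> l_class X I b =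
    (\<Union>a'\<in>l_class X I a. \<Union>b'\<in>l_class X I b. l_class X I (a' \<otimes> b'))"
    by (simp add: l_quot_def)
  also have "\<dots> = (\<Union>a'\<in>l_class X I a. \<Union>b'\<in>l_class X I b. l_class X I (a \<otimes> b))"
    by (intro SUP_cong refl eq)
  \<comment> \<open>A union of a constant family has that constant as its value only over nonempty
    index sets, hence the representatives \<open>a\<close> and \<open>b\<close> themselves.\<close>
  also have "\<dots> = l_class X I (a \<otimes> b)"
    using self_in_l_class[OF I a] self_in_l_class[OF I b] by blast
  finally show ?thesis .
qed

section \<open>Kernels and the first isomorphism theorem\<close>

text \<open>The laws needed among values of \<open>f\<close> are carried over from \<open>X\<close>,
  so \<open>T\<close> may be any structure, in particular a semidirect product of quotients not yet
  known to be an L-algebra.\<close>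

lemma kernel_l_ideal:
  assumes f: "f \<in> hom X T"
  shows "l_ideal X {x \<in> carrier X. f x = f \<one>}"
proof -
  have left: "f (x \<otimes> y) = f y" if "x \<in> carrier X" "f x = f \<one>" "y \<in> carrier X" for x y
    using that hom_mult[OF f] one_closed one_op by metis
  have right: "f (y \<otimes> x) = f \<one>" if "x \<in> carrier X" "f x = f \<one>" "y \<in> carrier X" for x y
    using that hom_mult[OF f] one_closed op_one by metis
  have cong: "f (x \<otimes> z) = f (y \<otimes> z)" "f (z \<otimes> x) = f (z \<otimes> y)"
    if "f x = f y" "x \<in> carrier X" "y \<in> carrier X" "z \<in> carrier X" for x y z
    using that hom_mult[OF f] by metis+
  show ?thesis
    unfolding l_ideal_def
  proof (intro conjI ballI impI)
    show "{x \<in> carrier X. f x = f \<one>} \<noteq> {}"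
      using one_closed by blast
    fix x y
    assume x: "x \<in> {x \<in> carrier X. f x = f \<one>}" and y: "y \<in> carrier X"
    \<comment> \<open>Since \<open>x \<otimes> y\<close> and \<open>y\<close> have the same value,
      (I1) is immediate, and in (I3) and (I4) the product has the value of
      \<open>y \<otimes> y = \<one>\<close>.\<close>
    then have xy: "f (x \<otimes> y) = f y" "x \<otimes> y \<in> carrier X"
      using left op_closed by auto
    show "y \<in> {x \<in> carrier X. f x = f \<one>}" if "x \<otimes> y \<in> {x \<in> carrier X. f x = f \<one>}"
      using that xy y by simp
    show "y \<otimes> x \<in> {x \<in> carrier X. f x = f \<one>}"
      using x y right op_closed by simp
    show "(x \<otimes> y) \<otimes> y \<in> {x \<in> carrier X. f x = f \<one>}"
      using cong(1)[OF xy(1) xy(2) y y] xy(2) y by (simp add: op_self op_closed)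
    show "y \<otimes> (x \<otimes> y) \<in> {x \<in> carrier X. f x = f \<one>}"
      using cong(2)[OF xy(1) xy(2) y y] xy(2) y by (simp add: op_self op_closed)
  qed blast
qed

text \<open>The assumption concerns the kernel pair and not just the kernel: to get
  \<open>f x = f y\<close> from \<open>x \<otimes> y\<close> and \<open>y \<otimes> x\<close> lying
  in the kernel would take antisymmetry in \<open>T\<close>.\<close>

lemma l_quot_iso:
  assumes I: "l_ideal X I" and f: "f \<in> hom X T" and surj: "f ` carrier X = carrier T"
    and ker: "\<And>x y. \<lbrakk>x \<in> carrier X; y \<in> carrier X\<rbrakk> \<Longrightarrow> f x = f y \<longleftrightarrow> (x, y) \<in> l_cong X I"
  shows "l_quot X I \<cong> T"
proof -
  \<comment> \<open>\<open>f\<close> is constant on each class, so the image of a class is a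
    singleton.\<close>
  define g where "g A = the_elem (f ` A)" for A
  have g: "g (l_class X I x) = f x" if x: "x \<in> carrier X" for x
  proof -
    have "f y = f x" if "y \<in> l_class X I x" for y
    proof -
      have "(x, y) \<in> l_cong X I" "y \<in> carrier X"
        using that unfolding l_class_def l_cong_def by auto
      then show ?thesis
        using ker x by metis
    qed
    then have "f ` l_class X I x = {f x}"
      using self_in_l_class[OF I x] by blast
    then show ?thesis
      by (simp add: g_def)
  qed
  note carr = carrier_l_quot[of X I]
  have "g \<in> hom (l_quot X I) T"
    using g hom_mult[OF f] op_closed surj
    by (intro homI) (auto simp: carr l_class_mult[OF I])
  moreover have "bij_betw g (carrier (l_quot X I)) (carrier T)"
  proof (rule bij_betw_imageI)
    show "inj_on g (carrier (l_quot X I))"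
      using g ker l_class_eq_iff[OF I] by (auto simp: carr inj_on_def)
    show "g ` carrier (l_quot X I) = carrier T"
      unfolding carr image_image surj[symmetric] using g by (intro image_cong) auto
  qed
  ultimately show ?thesis
    unfolding is_iso_def iso_def by blast
qed

end

section \<open>The semidirect product as an L-algebra\<close>

lemma carrier_semidirect [simp]: "carrier (semidirect X \<rho> Y) = carrier X \<times> carrier Y"
  by (simp add: semidirect_def)

lemma one_semidirect [simp]: "\<one>\<^bsub>semidirect X \<rho> Y\<^esub> = (\<one>\<^bsub>X\<^esub>, \<one>\<^bsub>Y\<^esub>)"
  by (simp add: semidirect_def)

lemma mult_semidirect [simp]:
  "(x, u) \<otimes>\<^bsub>semidirect X \<rho> Y\<^esub> (y, v) =
    (\<rho> (u \<otimes>\<^bsub>Y\<^esub> v) x \<otimes>\<^bsub>X\<^esub> \<rho> (v \<otimes>\<^bsub>Y\<^esub> u) y, u \<otimes>\<^bsub>Y\<^esub> v)"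
  by (simp add: semidirect_def)

locale l_operation = X: l_algebra X + Y: l_algebra Y
  for X :: "('a, 'm) monoid_scheme" and Y :: "('b, 'n) monoid_scheme"
    and \<rho> :: "'b \<Rightarrow> 'a \<Rightarrow> 'a" +
  assumes operates: "operates Y X \<rho>"
begin

lemma act_closed: "\<lbrakk>u \<in> carrier Y; x \<in> carrier X\<rbrakk> \<Longrightarrow> \<rho> u x \<in> carrier X"
  using operates unfolding operates_def hom_def by blast

lemma act_mult:
  "\<lbrakk>u \<in> carrier Y; x \<in> carrier X; y \<in> carrier X\<rbrakk>
    \<Longrightarrow> \<rho> u (x \<otimes>\<^bsub>X\<^esub> y) = \<rho> u x \<otimes>\<^bsub>X\<^esub> \<rho> u y"
  using operates unfolding operates_def hom_def by blast

lemma one_act: "x \<in> carrier X \<Longrightarrow> \<rho> \<one>\<^bsub>Y\<^esub> x = x"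
  using operates unfolding operates_def by blast

lemma act_comm:
  "\<lbrakk>u \<in> carrier Y; v \<in> carrier Y; x \<in> carrier X\<rbrakk>
    \<Longrightarrow> \<rho> (u \<otimes>\<^bsub>Y\<^esub> v) (\<rho> u x) = \<rho> (v \<otimes>\<^bsub>Y\<^esub> u) (\<rho> v x)"
  using operates unfolding operates_def by blast

lemma act_one: "u \<in> carrier Y \<Longrightarrow> \<rho> u \<one>\<^bsub>X\<^esub> = \<one>\<^bsub>X\<^esub>"
  by (metis act_closed act_mult X.one_closed X.op_self)

lemmas op_simps = act_closed act_one one_act X.one_closed X.op_closed X.one_op X.op_one X.op_self
  Y.one_closed Y.op_closed Y.one_op Y.op_one Y.op_self

text \<open>After expansion the first components are
  \<open>(A \<otimes> B) \<otimes> (A \<otimes> C)\<close> and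
  \<open>(B \<otimes> A) \<otimes> (B \<otimes> C)\<close>. Here \<open>A\<close>, \<open>B\<close>,
  \<open>C\<close> are \<open>x\<close>, \<open>y\<close>, \<open>z\<close>, each moved by two
  successive actions; by \<open>act_comm\<close> and the cycloid law in \<open>Y\<close> the order
  of the two does not matter.\<close>

lemma semidirect_cycloid:
  assumes x: "x \<in> carrier X" "y \<in> carrier X" "z \<in> carrier X"
    and u: "u \<in> carrier Y" "v \<in> carrier Y" "w \<in> carrier Y"
  defines "S \<equiv> semidirect X \<rho> Y"
  shows "((x, u) \<otimes>\<^bsub>S\<^esub> (y, v)) \<otimes>\<^bsub>S\<^esub> ((x, u) \<otimes>\<^bsub>S\<^esub> (z, w)) =
    ((y, v) \<otimes>\<^bsub>S\<^esub> (x, u)) \<otimes>\<^bsub>S\<^esub> ((y, v) \<otimes>\<^bsub>S\<^esub> (z, w))"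
proof -
  let ?m = "\<lambda>a b. a \<otimes>\<^bsub>Y\<^esub> b"
  define A where "A = \<rho> (?m (?m u v) (?m u w)) (\<rho> (?m u v) x)"
  define B where "B = \<rho> (?m (?m u v) (?m u w)) (\<rho> (?m v u) y)"
  define C where "C = \<rho> (?m (?m u w) (?m u v)) (\<rho> (?m w u) z)"
  have cy: "?m (?m v u) (?m v w) = ?m (?m u v) (?m u w)"
    "?m (?m w u) (?m w v) = ?m (?m u w) (?m u v)" "?m (?m w v) (?m w u) = ?m (?m v w) (?m v u)"
    using u by (simp_all add: Y.cycloid)
  have A': "\<rho> (?m (?m u w) (?m u v)) (\<rho> (?m u w) x) = A"
    unfolding A_def using x u by (intro act_comm op_simps)
  have B': "\<rho> (?m (?m v w) (?m v u)) (\<rho> (?m v w) y) = B"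
    unfolding B_def cy(1)[symmetric] using x u by (intro act_comm op_simps)
  have C': "\<rho> (?m (?m v w) (?m v u)) (\<rho> (?m w v) z) = C"
    unfolding C_def cy(2,3)[symmetric] using x u by (intro act_comm op_simps)
  have "A \<in> carrier X" "B \<in> carrier X" "C \<in> carrier X"
    using x u by (simp_all add: A_def B_def C_def op_simps)
  then have "(A \<otimes>\<^bsub>X\<^esub> B) \<otimes>\<^bsub>X\<^esub> (A \<otimes>\<^bsub>X\<^esub> C) = (B \<otimes>\<^bsub>X\<^esub> A) \<otimes>\<^bsub>X\<^esub> (B \<otimes>\<^bsub>X\<^esub> C)"
    by (rule X.cycloid)
  then show ?thesis
    using x u
    by (simp add: S_def act_mult op_simps cy(1) A' B' C' A_def[symmetric] B_def[symmetric]
        C_def[symmetric])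
qed

lemma semidirect_l_algebra: "l_algebra (semidirect X \<rho> Y)" (is "l_algebra ?S")
proof (rule l_algebra.intro)
  show "\<one>\<^bsub>?S\<^esub> \<in> carrier ?S"
    by (simp add: op_simps)
next
  fix p q
  assume "p \<in> carrier ?S" "q \<in> carrier ?S"
  then show "p \<otimes>\<^bsub>?S\<^esub> q \<in> carrier ?S"
    unfolding carrier_semidirect by (elim SigmaE) (simp add: op_simps)
next
  fix p
  assume p: "p \<in> carrier ?S"
  show "\<one>\<^bsub>?S\<^esub> \<otimes>\<^bsub>?S\<^esub> p = p"
    using p unfolding carrier_semidirect by (elim SigmaE) (simp add: op_simps)
  show "p \<otimes>\<^bsub>?S\<^esub> \<one>\<^bsub>?S\<^esub> = \<one>\<^bsub>?S\<^esub>"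
    using p unfolding carrier_semidirect by (elim SigmaE) (simp add: op_simps)
  show "p \<otimes>\<^bsub>?S\<^esub> p = \<one>\<^bsub>?S\<^esub>"
    using p unfolding carrier_semidirect by (elim SigmaE) (simp add: op_simps)
next
  fix p q r
  assume "p \<in> carrier ?S" "q \<in> carrier ?S" "r \<in> carrier ?S"
  then show "(p \<otimes>\<^bsub>?S\<^esub> q) \<otimes>\<^bsub>?S\<^esub> (p \<otimes>\<^bsub>?S\<^esub> r) = (q \<otimes>\<^bsub>?S\<^esub> p) \<otimes>\<^bsub>?S\<^esub> (q \<otimes>\<^bsub>?S\<^esub> r)"
    unfolding carrier_semidirect by (elim SigmaE) (hypsubst, rule semidirect_cycloid)
next
  fix p q
  assume "p \<in> carrier ?S" "q \<in> carrier ?S"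
    and one: "p \<otimes>\<^bsub>?S\<^esub> q = \<one>\<^bsub>?S\<^esub>" "q \<otimes>\<^bsub>?S\<^esub> p = \<one>\<^bsub>?S\<^esub>"
  then obtain x u y v where
    pq: "p = (x, u)" "q = (y, v)" "x \<in> carrier X" "y \<in> carrier X" "u \<in> carrier Y" "v \<in> carrier Y"
    unfolding carrier_semidirect by blast
  have "u = v"
    using one pq Y.antisym[of u v] by simp
  \<comment> \<open>Once \<open>u = v\<close>, both acting elements are
    \<open>u \<otimes> u = \<one>\<close>, and the first components are plain products in
    \<open>X\<close>.\<close>
  moreover have "x = y"
    using one pq X.antisym[of x y] \<open>u = v\<close> by (simp add: op_simps)
  ultimately show "p = q"
    using pq by simp
qed

section \<open>From an induced map to an ideal and an operation on the quotients\<close>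

context
  fixes I J
  assumes I: "l_ideal X I" and J: "l_ideal Y J"
begin

lemma l_class_pair_hom:
  assumes ind: "induces X I Y J \<rho> \<rho>'"
  shows "(\<lambda>(x, u). (l_class X I x, l_class Y J u)) \<in>
    hom (semidirect X \<rho> Y) (semidirect (l_quot X I) \<rho>' (l_quot Y J))"
proof -
  have "\<rho>' (l_class Y J v) (l_class X I x) = l_class X I (\<rho> v x)"
    if "v \<in> carrier Y" "x \<in> carrier X" for v x
    using ind that unfolding induces_def by blast
  then show ?thesis
    by (intro homI) (auto simp: carrier_l_quot X.l_class_mult[OF I] Y.l_class_mult[OF J] op_simps)
qed

lemma Times_l_ideal:
  assumes "induces X I Y J \<rho> \<rho>'"
  shows "l_ideal (semidirect X \<rho> Y) (I \<times> J)"
proof -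
  interpret S: l_algebra "semidirect X \<rho> Y"
    by (rule semidirect_l_algebra)
  have I_iff: "x \<in> I \<longleftrightarrow> x \<in> carrier X \<and> l_class X I x = l_class X I \<one>\<^bsub>X\<^esub>" for x
    using l_ideal_mem_carrier[OF I] X.l_class_eq_one_iff[OF I] by blast
  have J_iff: "u \<in> J \<longleftrightarrow> u \<in> carrier Y \<and> l_class Y J u = l_class Y J \<one>\<^bsub>Y\<^esub>" for u
    using l_ideal_mem_carrier[OF J] Y.l_class_eq_one_iff[OF J] by blast
  have "I \<times> J = {p \<in> carrier (semidirect X \<rho> Y).
    (\<lambda>(x, u). (l_class X I x, l_class Y J u)) p =
    (\<lambda>(x, u). (l_class X I x, l_class Y J u)) \<one>\<^bsub>semidirect X \<rho> Y\<^esub>}"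
    by (rule Set.set_eqI) (auto simp: I_iff J_iff)
  then show ?thesis
    using S.kernel_l_ideal[OF l_class_pair_hom[OF assms]] by metis
qed

lemma induced_operates:
  assumes ind: "induces X I Y J \<rho> \<rho>'"
  shows "operates (l_quot Y J) (l_quot X I) \<rho>'"
proof -
  have r: "\<rho>' (l_class Y J v) (l_class X I x) = l_class X I (\<rho> v x)"
    if "v \<in> carrier Y" "x \<in> carrier X" for v x
    using ind that unfolding induces_def by blast
  have "\<one>\<^bsub>l_quot Y J\<^esub> = l_class Y J \<one>\<^bsub>Y\<^esub>"
    by (simp add: l_quot_def)
  then show ?thesis
    unfolding operates_def carrier_l_quot
    by (auto intro!: homI simp: r carrier_l_quot X.l_class_mult[OF I] Y.l_class_mult[OF J] op_simps
        act_mult act_comm)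
qed

end

section \<open>From an ideal of the semidirect product to the induced operation\<close>

context
  fixes K K_X K_Y
  assumes K: "l_ideal (semidirect X \<rho> Y) K"
    and K_X: "K_X = {x \<in> carrier X. (x, \<one>\<^bsub>Y\<^esub>) \<in> K}"
    and K_Y: "K_Y = {y \<in> carrier Y. (\<one>\<^bsub>X\<^esub>, y) \<in> K}"
begin

lemma ideal_eq_Times: "K = K_X \<times> K_Y"
proof -
  interpret S: l_algebra "semidirect X \<rho> Y"
    by (rule semidirect_l_algebra)
  have "(x, u) \<in> K \<longleftrightarrow> (x, \<one>\<^bsub>Y\<^esub>) \<in> K \<and> (\<one>\<^bsub>X\<^esub>, u) \<in> K"
    if "x \<in> carrier X" "u \<in> carrier Y" for x u
  proof
    assume xu: "(x, u) \<in> K"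
    \<comment> \<open>\<open>(x, u) \<cdot> (1, u) = (1, 1)\<close> gives
      \<open>(1, u) \<in> K\<close> by (I1); \<open>(1, u) \<cdot> (x, u) = (x, 1)\<close> is in
      \<open>K\<close> by (I2).\<close>
    show "(x, \<one>\<^bsub>Y\<^esub>) \<in> K \<and> (\<one>\<^bsub>X\<^esub>, u) \<in> K"
      using that S.l_ideal_one[OF K] l_ideal_I1[OF K xu, of "(\<one>\<^bsub>X\<^esub>, u)"]
        l_ideal_I2[OF K xu, of "(\<one>\<^bsub>X\<^esub>, u)"]
      by (simp add: op_simps)
  next
    assume "(x, \<one>\<^bsub>Y\<^esub>) \<in> K \<and> (\<one>\<^bsub>X\<^esub>, u) \<in> K"
    then have x: "(x, \<one>\<^bsub>Y\<^esub>) \<in> K" and u: "(\<one>\<^bsub>X\<^esub>, u) \<in> K"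
      by auto
    \<comment> \<open>The same product \<open>(1, u) \<cdot> (x, u) = (x, 1)\<close> is now read
      backwards with (I1).\<close>
    show "(x, u) \<in> K"
      using that x l_ideal_I1[OF K u, of "(x, u)"] by (simp add: op_simps)
  qed
  then show ?thesis
    using l_ideal_mem_carrier[OF K] unfolding K_X K_Y by auto
qed

text \<open>Pairs \<open>(x, 1)\<close> multiply as in \<open>X\<close>, so each condition is that
  of \<open>K\<close> at such pairs. Likewise the pairs \<open>(1, u)\<close> give
  \<open>ideal_snd\<close>.\<close>

lemma ideal_fst: "l_ideal X K_X"
proof -
  interpret S: l_algebra "semidirect X \<rho> Y"
    by (rule semidirect_l_algebra)
  have "K_X \<noteq> {}"
    using S.l_ideal_one[OF K] X.one_closed unfolding K_X by auto
  moreover have "(x \<otimes>\<^bsub>X\<^esub> y \<in> K_X \<longrightarrow> y \<in> K_X) \<and> y \<otimes>\<^bsub>X\<^esub> x \<in> K_X \<and>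
      (x \<otimes>\<^bsub>X\<^esub> y) \<otimes>\<^bsub>X\<^esub> y \<in> K_X \<and> y \<otimes>\<^bsub>X\<^esub> (x \<otimes>\<^bsub>X\<^esub> y) \<in> K_X"
    if "x \<in> K_X" "y \<in> carrier X" for x y
  proof -
    have "x \<in> carrier X" and x: "(x, \<one>\<^bsub>Y\<^esub>) \<in> K"
      using that unfolding K_X by auto
    then show ?thesis
      using that l_ideal_I1[OF K x, of "(y, \<one>\<^bsub>Y\<^esub>)"] l_ideal_I2[OF K x, of "(y, \<one>\<^bsub>Y\<^esub>)"]
        l_ideal_I3[OF K x, of "(y, \<one>\<^bsub>Y\<^esub>)"] l_ideal_I4[OF K x, of "(y, \<one>\<^bsub>Y\<^esub>)"]
      unfolding K_X by (simp add: op_simps)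
  qed
  ultimately show ?thesis
    unfolding l_ideal_def K_X by blast
qed

lemma ideal_snd: "l_ideal Y K_Y"
proof -
  interpret S: l_algebra "semidirect X \<rho> Y"
    by (rule semidirect_l_algebra)
  have "K_Y \<noteq> {}"
    using S.l_ideal_one[OF K] Y.one_closed unfolding K_Y by auto
  moreover have "(x \<otimes>\<^bsub>Y\<^esub> y \<in> K_Y \<longrightarrow> y \<in> K_Y) \<and> y \<otimes>\<^bsub>Y\<^esub> x \<in> K_Y \<and>
      (x \<otimes>\<^bsub>Y\<^esub> y) \<otimes>\<^bsub>Y\<^esub> y \<in> K_Y \<and> y \<otimes>\<^bsub>Y\<^esub> (x \<otimes>\<^bsub>Y\<^esub> y) \<in> K_Y"
    if "x \<in> K_Y" "y \<in> carrier Y" for x y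
  proof -
    have "x \<in> carrier Y" and x: "(\<one>\<^bsub>X\<^esub>, x) \<in> K"
      using that unfolding K_Y by auto
    then show ?thesis
      using that l_ideal_I1[OF K x, of "(\<one>\<^bsub>X\<^esub>, y)"] l_ideal_I2[OF K x, of "(\<one>\<^bsub>X\<^esub>, y)"]
        l_ideal_I3[OF K x, of "(\<one>\<^bsub>X\<^esub>, y)"] l_ideal_I4[OF K x, of "(\<one>\<^bsub>X\<^esub>, y)"]
      unfolding K_Y by (simp add: op_simps)
  qed
  ultimately show ?thesis
    unfolding l_ideal_def K_Y by blast
qed

lemma act_ideal:
  assumes v: "v \<in> carrier Y" and x: "x \<in> K_X"
  shows "\<rho> v x \<in> K_X"
proof -
  have xc: "x \<in> carrier X" and xK: "(x, \<one>\<^bsub>Y\<^esub>) \<in> K"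
    using x unfolding K_X by auto
  then show ?thesis
    using v l_ideal_I2[OF K xK, of "(\<one>\<^bsub>X\<^esub>, v)"] unfolding K_X by (simp add: op_simps)
qed

text \<open>With \<open>(1, w) \<cdot> (x, 1) = (\<rho> w x, 1)\<close>, (I3) yields
  \<open>(\<rho> w x \<cdot> x, 1) \<in> K\<close> and (I4) yields
  \<open>(x \<cdot> \<rho> w x, 1) \<in> K\<close>.\<close>

lemma ideal_act_cong:
  assumes w: "w \<in> K_Y" and x: "x \<in> carrier X"
  shows "(x, \<rho> w x) \<in> l_cong X K_X"
proof -
  have wc: "w \<in> carrier Y" and wK: "(\<one>\<^bsub>X\<^esub>, w) \<in> K"
    using w unfolding K_Y by auto
  then show ?thesis
    using l_ideal_I3[OF K wK, of "(x, \<one>\<^bsub>Y\<^esub>)"] l_ideal_I4[OF K wK, of "(x, \<one>\<^bsub>Y\<^esub>)"] x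
    unfolding l_cong_def K_X by (simp add: op_simps)
qed

lemma ideal_act_class:
  assumes "w \<in> K_Y" and "x \<in> carrier X"
  shows "l_class X K_X (\<rho> w x) = l_class X K_X x"
  using ideal_act_cong[OF assms] assms X.l_class_eq_iff[OF ideal_fst] act_closed
    l_ideal_mem_carrier[OF ideal_snd] by metis

text \<open>First \<open>v\<close> is replaced at fixed \<open>x\<close>: both
  \<open>v \<otimes> v'\<close> and \<open>v' \<otimes> v\<close> lie in \<open>K_Y\<close> and act
  trivially on classes, and \<open>act_comm\<close> links the two. Then \<open>x\<close> is
  replaced, as \<open>\<rho> v'\<close> is a homomorphism preserving \<open>K_X\<close>.\<close>

lemma act_class_cong:
  assumes vv': "(v, v') \<in> l_cong Y K_Y" and xx': "(x, x') \<in> l_cong X K_X"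
  shows "l_class X K_X (\<rho> v x) = l_class X K_X (\<rho> v' x')"
proof -
  have v: "v \<in> carrier Y" "v' \<in> carrier Y" "v \<otimes>\<^bsub>Y\<^esub> v' \<in> K_Y" "v' \<otimes>\<^bsub>Y\<^esub> v \<in> K_Y"
    using vv' unfolding l_cong_def by auto
  have x: "x \<in> carrier X" "x' \<in> carrier X" "x \<otimes>\<^bsub>X\<^esub> x' \<in> K_X" "x' \<otimes>\<^bsub>X\<^esub> x \<in> K_X"
    using xx' unfolding l_cong_def by auto
  have "l_class X K_X (\<rho> v x) = l_class X K_X (\<rho> (v \<otimes>\<^bsub>Y\<^esub> v') (\<rho> v x))"
    using v x by (simp add: ideal_act_class op_simps)
  also have "\<dots> = l_class X K_X (\<rho> (v' \<otimes>\<^bsub>Y\<^esub> v) (\<rho> v' x))"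
    using v x by (simp add: act_comm)
  also have "\<dots> = l_class X K_X (\<rho> v' x)"
    using v x by (simp add: ideal_act_class op_simps)
  also have "\<dots> = l_class X K_X (\<rho> v' x')"
  proof -
    have "(\<rho> v' x, \<rho> v' x') \<in> l_cong X K_X"
      using v x act_ideal act_mult act_closed unfolding l_cong_def by auto (metis+)
    then show ?thesis
      using X.l_class_eq_iff[OF ideal_fst] v x act_closed by metis
  qed
  finally show ?thesis .
qed

lemma ex_induced: "\<exists>\<rho>'. induces X K_X Y K_Y \<rho> \<rho>'"
proof
  \<comment> \<open>As in \<open>l_quot\<close>, the union over all representatives avoids a choice;
    by \<open>act_class_cong\<close> it runs over copies of one class.\<close>
  show "induces X K_X Y K_Y \<rho> (\<lambda>V Z. \<Union>v\<in>V. \<Union>x\<in>Z. l_class X K_X (\<rho> v x))"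
    unfolding induces_def
  proof (intro ballI)
    fix v x
    assume v: "v \<in> carrier Y" and x: "x \<in> carrier X"
    have eq: "l_class X K_X (\<rho> v' x') = l_class X K_X (\<rho> v x)"
      if "v' \<in> l_class Y K_Y v" "x' \<in> l_class X K_X x" for v' x'
      using act_class_cong[of v v' x x'] that unfolding l_class_def by simp
    have "(\<Union>v'\<in>l_class Y K_Y v. \<Union>x'\<in>l_class X K_X x. l_class X K_X (\<rho> v' x')) =
      (\<Union>v'\<in>l_class Y K_Y v. \<Union>x'\<in>l_class X K_X x. l_class X K_X (\<rho> v x))"
      by (intro SUP_cong refl eq)
    also have "\<dots> = l_class X K_X (\<rho> v x)"
      using Y.self_in_l_class[OF ideal_snd v] X.self_in_l_class[OF ideal_fst x] by blast
    finally show "(\<Union>v'\<in>l_class Y K_Y v. \<Union>x'\<in>l_class X K_X x. l_class X K_X (\<rho> v' x')) =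
      l_class X K_X (\<rho> v x)" .
  qed
qed

lemma semidirect_l_cong_iff:
  assumes x: "x \<in> carrier X" "y \<in> carrier X" and u: "u \<in> carrier Y" "v \<in> carrier Y"
  shows "((x, u), (y, v)) \<in> l_cong (semidirect X \<rho> Y) K \<longleftrightarrow>
    (x, y) \<in> l_cong X K_X \<and> (u, v) \<in> l_cong Y K_Y"
proof -
  let ?x = "\<rho> (u \<otimes>\<^bsub>Y\<^esub> v) x" and ?y = "\<rho> (v \<otimes>\<^bsub>Y\<^esub> u) y"
  have "((x, u), (y, v)) \<in> l_cong (semidirect X \<rho> Y) K \<longleftrightarrow>
    (?x, ?y) \<in> l_cong X K_X \<and> (u, v) \<in> l_cong Y K_Y"
    using x u unfolding l_cong_def ideal_eq_Times by (auto simp: op_simps)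
  \<comment> \<open>The twists in the first component come from \<open>u \<otimes> v\<close> and
    \<open>v \<otimes> u\<close>. For congruent \<open>u\<close> and \<open>v\<close> these lie in
    \<open>K_Y\<close>, so they leave the classes of \<open>x\<close> and \<open>y\<close>
    unchanged.\<close>
  moreover have "(?x, ?y) \<in> l_cong X K_X \<longleftrightarrow> (x, y) \<in> l_cong X K_X"
    if "(u, v) \<in> l_cong Y K_Y"
  proof -
    have "u \<otimes>\<^bsub>Y\<^esub> v \<in> K_Y" "v \<otimes>\<^bsub>Y\<^esub> u \<in> K_Y"
      using that unfolding l_cong_def by auto
    then show ?thesis
      using x u by (simp add: X.l_class_eq_iff[OF ideal_fst, symmetric] ideal_act_class op_simps)
  qed
  ultimately show ?thesis
    by blast
qed

lemma semidirect_quot_iso: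
  assumes ind: "induces X K_X Y K_Y \<rho> \<rho>'"
  shows "l_quot (semidirect X \<rho> Y) K \<cong> semidirect (l_quot X K_X) \<rho>' (l_quot Y K_Y)"
proof -
  interpret S: l_algebra "semidirect X \<rho> Y"
    by (rule semidirect_l_algebra)
  show ?thesis
  proof (rule S.l_quot_iso[OF K l_class_pair_hom[OF ideal_fst ideal_snd ind]])
    show "(\<lambda>(x, u). (l_class X K_X x, l_class Y K_Y u)) ` carrier (semidirect X \<rho> Y) =
      carrier (semidirect (l_quot X K_X) \<rho>' (l_quot Y K_Y))"
      by (auto simp: carrier_l_quot)
  next
    fix p q
    assume "p \<in> carrier (semidirect X \<rho> Y)" "q \<in> carrier (semidirect X \<rho> Y)"
    then show "(\<lambda>(x, u). (l_class X K_X x, l_class Y K_Y u)) p =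
        (\<lambda>(x, u). (l_class X K_X x, l_class Y K_Y u)) q \<longleftrightarrow>
      (p, q) \<in> l_cong (semidirect X \<rho> Y) K"
      unfolding carrier_semidirect
      by (elim SigmaE) (simp add: semidirect_l_cong_iff X.l_class_eq_iff[OF ideal_fst]
          Y.l_class_eq_iff[OF ideal_snd])
  qed
qed

end

end

text \<open>The conjunct \<open>K = ...\<close> ties \<open>K\<close> to the rest of the right-hand
  side, which sees it only through \<open>K_X\<close> and \<open>K_Y\<close>. The two ideal
  conjuncts make the quotients of \<open>X\<close> and \<open>Y\<close> meaningful; for the quotient
  of the semidirect product, \<open>Times_l_ideal\<close> does so.\<close>

theorem theorem3p8:
  fixes X :: "('a, 'm) monoid_scheme" and Y :: "('b, 'n) monoid_scheme"
    and \<rho> :: "'b \<Rightarrow> 'a \<Rightarrow> 'a" and K :: "('a \<times> 'b) set"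
    and K_X :: "'a set" and K_Y :: "'b set"
  assumes "l_algebra X" and "l_algebra Y"
    and "operates Y X \<rho>"
    and "K \<subseteq> carrier (semidirect X \<rho> Y)"
    and "K_X = {x \<in> carrier X. (x, \<one>\<^bsub>Y\<^esub>) \<in> K}"
    and "K_Y = {y \<in> carrier Y. (\<one>\<^bsub>X\<^esub>, y) \<in> K}"
  shows "l_ideal (semidirect X \<rho> Y) K \<longleftrightarrow>
    K = carrier (semidirect (X\<lparr>carrier := K_X\<rparr>) \<rho> (Y\<lparr>carrier := K_Y\<rparr>)) \<and>
    l_ideal X K_X \<and> l_ideal Y K_Y \<and>
    (\<exists>\<rho>'. induces X K_X Y K_Y \<rho> \<rho>' \<and>
      operates (l_quot Y K_Y) (l_quot X K_X) \<rho>' \<and>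
      l_quot (semidirect X \<rho> Y)
          (carrier (semidirect (X\<lparr>carrier := K_X\<rparr>) \<rho> (Y\<lparr>carrier := K_Y\<rparr>)))
        \<cong> semidirect (l_quot X K_X) \<rho>' (l_quot Y K_Y))"
proof -
  interpret l_operation X Y \<rho>
    using assms(1-3) by (intro l_operation.intro l_operation_axioms.intro)
  have carr: "carrier (semidirect (X\<lparr>carrier := K_X\<rparr>) \<rho> (Y\<lparr>carrier := K_Y\<rparr>)) = K_X \<times> K_Y"
    by simp
  show ?thesis
    unfolding carr
  proof
    assume K: "l_ideal (semidirect X \<rho> Y) K"
    note ideal = K assms(5,6)
    obtain \<rho>' where ind: "induces X K_X Y K_Y \<rho> \<rho>'"
      using ex_induced[OF ideal] by blast
    note facts = ideal_eq_Times[OF ideal] ideal_fst[OF ideal] ideal_snd[OF ideal]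
    have "l_quot (semidirect X \<rho> Y) (K_X \<times> K_Y) \<cong> semidirect (l_quot X K_X) \<rho>' (l_quot Y K_Y)"
      using semidirect_quot_iso[OF ideal ind] unfolding facts(1)[symmetric] .
    then show "K = K_X \<times> K_Y \<and> l_ideal X K_X \<and> l_ideal Y K_Y \<and>
      (\<exists>\<rho>'. induces X K_X Y K_Y \<rho> \<rho>' \<and> operates (l_quot Y K_Y) (l_quot X K_X) \<rho>' \<and>
        l_quot (semidirect X \<rho> Y) (K_X \<times> K_Y) \<cong>
          semidirect (l_quot X K_X) \<rho>' (l_quot Y K_Y))"
      using facts ind induced_operates[OF facts(2,3) ind] by blast
  next
    assume "K = K_X \<times> K_Y \<and> l_ideal X K_X \<and> l_ideal Y K_Y \<and>
      (\<exists>\<rho>'. induces X K_X Y K_Y \<rho> \<rho>' \<and> operates (l_quot Y K_Y) (l_quot X K_X) \<rho>' \<and>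
        l_quot (semidirect X \<rho> Y) (K_X \<times> K_Y) \<cong>
          semidirect (l_quot X K_X) \<rho>' (l_quot Y K_Y))"
    then show "l_ideal (semidirect X \<rho> Y) K"
      using Times_l_ideal by metis
  qed
qed

end
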